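(* Let $(X,\delta,m)$ be a cell complex, let $k\in\mathbb{N}=\{1,2,\dots\}$ and let $R\in\mathbb{R}$. The following statements are equivalent: (i) $F(x)\ge R$ for all $k$-cells $x\in X_k$; (ii) $\|e^{-tH}f\|_p\le e^{-Rt}\|f\|_p$ for all $f\in C(X_k)$, all $p\in[1,\infty]$ and all $t\ge 0$.
   Context: For a finite set $X$, $C(X)=\mathbb{R}^X$, and $x\in X$ is identified with its indicator function $1_x\in C(X)$. A cell complex $K=(X,\delta,m)$ consists of a finite set of cells $X=\dot\bigcup_{k\ge 0}X_k$, a linear operator $\delta:C(X)\to C(X)$ (coboundary) and a weight $m:X\to(0,\infty)$. Write $\dim(z)=k$ iff $z\in X_k$, and $x\lessdot z$ (equivalently $z\gtrdot x$) iff $\delta x(z)\ne 0$. It is required that for all $v,z,z'\in X$: $\delta v(z)\in\{-1,0,1\}$; $\delta v(z)=0$ if $\dim(z)-\dim(v)\ne 1$; if $\dim(z)\ge 1$ there exists $x\lessdot z$; and (i) for every $x\in X_1$ there is exactly one $w\in X_0$ with $\delta w(x)=1$ and exactly one $w\in X_0$ with $\delta w(x)=-1$; (ii) if $\dim(z)-\dim(v)=2$ and $\{x:v\lessdot x\lessdot z\}\ne\emptyset$, then $|\{x:v\lessdot x\lessdot z\}|=2$ and $\{\delta v(x)\,\delta x(z):x\in X\}\supseteq\{-1,1\}$ (hence $\delta\delta=0$); (iii) for all $x,y\lessdot z$ there is a sequence $(x=x_0,\dots,x_n=y)$ of cells with $\delta x_i(x_{i-1})+\delta x_{i-1}(x_i)\ne0$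 for all $i=1,\dots,n$; (iv) if $\{x:x\lessdot z\}=\{x:x\lessdot z'\}$ and $\dim(z)\ge 1$, then $z=z'$. $C(X)$ carries the scalar product $\langle f,g\rangle=\sum_{x\in X}f(x)g(x)m(x)$, $\delta^*$ is the adjoint of $\delta$, and $H=\delta\delta^*+\delta^*\delta$ is the Hodge Laplacian; $H$ maps $C(X_k)$ to $C(X_k)$. The Forman curvature of $x\in X$ is $F(x)=Hx(x)-\sum_{y\ne x}|Hy(x)|$, the sum being over $y \in X\setminus\{x\}$. Norms: $\|f\|_p^p=\sum_x m(x)|f(x)|^p$ for $p\in[1,\infty)$ and $\|f\|_\infty=\max_x|f(x)|$. *)

theory Defs
  imports "HOL-Analysis.Analysis"
begin

text \<open>
  The finite set \<open>X\<close> of cells is the finite type \<open>'a\<close>, so \<open>C(X)\<close> is \<open>real ^ 'a\<close>, and the cell \<open>x\<close> is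
  identified with its indicator function \<open>axis x 1\<close>. The partition of \<open>X\<close> into the sets \<open>X\<^sub>k\<close> is given
  by the dimension function \<open>cdim\<close>.
\<close>

abbreviation cell_fun :: "'a::finite \<Rightarrow> real ^ 'a"
  where "cell_fun x \<equiv> axis x 1"

definition cells :: "('a \<Rightarrow> nat) \<Rightarrow> nat \<Rightarrow> 'a set"
  where "cells cdim k = {x. cdim x = k}"

definition cochains :: "('a::finite \<Rightarrow> nat) \<Rightarrow> nat \<Rightarrow> (real ^ 'a) set"
  where "cochains cdim k = {f. \<forall>x. x \<notin> cells cdim k \<longrightarrow> f $ x = 0}"

definition face :: "(real ^ 'a \<Rightarrow> real ^ 'a) \<Rightarrow> 'a::finite \<Rightarrow> 'a \<Rightarrow> bool"
  where "face \<delta> x z \<longleftrightarrow> \<delta> (cell_fun x) $ z \<noteq> 0"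

locale cell_complex =
  fixes cdim :: "'a::finite \<Rightarrow> nat"
    and \<delta> :: "real ^ 'a \<Rightarrow> real ^ 'a"
    and m :: "'a \<Rightarrow> real"
  assumes linear_coboundary: "linear \<delta>"
    and weight_pos: "m x > 0"
    and incidence: "\<delta> (cell_fun v) $ z \<in> {-1, 0, 1}"
    and incidence_dim: "cdim z \<noteq> cdim v + 1 \<Longrightarrow> \<delta> (cell_fun v) $ z = 0"
    and face_exists: "cdim z \<ge> 1 \<Longrightarrow> \<exists>x. face \<delta> x z"
    and edge_endpoints: "x \<in> cells cdim 1 \<Longrightarrow>
          (\<exists>!w. w \<in> cells cdim 0 \<and> \<delta> (cell_fun w) $ x = 1) \<and>
          (\<exists>!w. w \<in> cells cdim 0 \<and> \<delta> (cell_fun w) $ x = -1)"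
    and diamond: "cdim z = cdim v + 2 \<Longrightarrow> {x. face \<delta> v x \<and> face \<delta> x z} \<noteq> {} \<Longrightarrow>
          card {x. face \<delta> v x \<and> face \<delta> x z} = 2 \<and>
          {-1, 1} \<subseteq> range (\<lambda>x. \<delta> (cell_fun v) $ x * \<delta> (cell_fun x) $ z)"
    and faces_connected: "face \<delta> x z \<Longrightarrow> face \<delta> y z \<Longrightarrow>
          \<exists>(s :: nat \<Rightarrow> 'a) n. s 0 = x \<and> s n = y \<and>
            (\<forall>i\<in>{1..n}. \<delta> (cell_fun (s i)) $ s (i - 1) + \<delta> (cell_fun (s (i - 1))) $ s i \<noteq> 0)"
    and faces_determine: "{x. face \<delta> x z} = {x. face \<delta> x z'} \<Longrightarrow> cdim z \<ge> 1 \<Longrightarrow> z = z'"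

definition winner :: "('a::finite \<Rightarrow> real) \<Rightarrow> real ^ 'a \<Rightarrow> real ^ 'a \<Rightarrow> real"
  where "winner m f g = (\<Sum>x\<in>UNIV. f $ x * g $ x * m x)"

text \<open>
  The library constant \<^const>\<open>adjoint\<close> refers to the unweighted inner product of \<open>real ^ 'a\<close>; here the
  adjoint is taken with respect to \<open>winner m\<close>.
\<close>

definition wadjoint ::
  "('a::finite \<Rightarrow> real) \<Rightarrow> (real ^ 'a \<Rightarrow> real ^ 'a) \<Rightarrow> real ^ 'a \<Rightarrow> real ^ 'a"
  where "wadjoint m A = (THE B. \<forall>f g. winner m (A f) g = winner m f (B g))"

lemma wadjoint_unique:
  assumes m: "\<And>x. m x > 0" and B: "\<And>f g. winner m (A f) g = winner m f (B g)"
  shows "wadjoint m A = B"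
  unfolding wadjoint_def
proof (rule the_equality)
  show "\<forall>f g. winner m (A f) g = winner m f (B g)" using B by blast
next
  fix C assume C: "\<forall>f g. winner m (A f) g = winner m f (C g)"
  have delta: "winner m (cell_fun x) h = h $ x * m x" for x h
  proof -
    have "winner m (cell_fun x) h = (\<Sum>y\<in>UNIV. if y = x then h $ y * m y else 0)"
      unfolding winner_def by (rule sum.cong) (auto simp: axis_def)
    then show ?thesis by simp
  qed
  have "C g $ x * m x = B g $ x * m x" for g x
    using B C delta by metis
  then show "C = B"
    using m by (metis ext less_irrefl mult_cancel_right vec_eq_iff)
qed

lemma winner_wadjoint:
  assumes m: "\<And>x. m x > 0" and A: "linear A"
  shows "winner m (A f) g = winner m f (wadjoint m A g)"
proof -
  define D where "D = (\<lambda>h :: real ^ 'a. \<chi> x. m x * h $ x)"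
  define D' where "D' = (\<lambda>h :: real ^ 'a. \<chi> x. h $ x / m x)"
  have w: "winner m f g = f \<bullet> D g" for f g
    by (simp add: winner_def D_def inner_vec_def mult_ac)
  have DD': "D (D' h) = h" for h
    using m by (simp add: D_def D'_def vec_eq_iff less_imp_neq[THEN not_sym])
  have "winner m (A f) g = winner m f (D' (adjoint A (D g)))" for f g
    by (simp add: w DD' adjoint_works[OF A])
  then show ?thesis
    using wadjoint_unique[of m A "\<lambda>g. D' (adjoint A (D g))"] m by metis
qed

definition hodge ::
  "(real ^ 'a \<Rightarrow> real ^ 'a) \<Rightarrow> ('a::finite \<Rightarrow> real) \<Rightarrow> real ^ 'a \<Rightarrow> real ^ 'a"
  where "hodge \<delta> m f = \<delta> (wadjoint m \<delta> f) + wadjoint m \<delta> (\<delta> f)"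

definition forman_curvature ::
  "(real ^ 'a \<Rightarrow> real ^ 'a) \<Rightarrow> ('a::finite \<Rightarrow> real) \<Rightarrow> 'a \<Rightarrow> real"
  where "forman_curvature \<delta> m x =
    hodge \<delta> m (cell_fun x) $ x - (\<Sum>y\<in>UNIV - {x}. \<bar>hodge \<delta> m (cell_fun y) $ x\<bar>)"

text \<open>
  The library's \<^const>\<open>exp\<close> needs a normed algebra with unit of norm 1, for which linear operators
  have no instance; hence the exponential series is applied pointwise to a vector.
\<close>

definition op_exp :: "(real ^ 'a \<Rightarrow> real ^ 'a) \<Rightarrow> real ^ 'a \<Rightarrow> real ^ 'a::finite"
  where "op_exp A f = (\<Sum>n. (A ^^ n) f /\<^sub>R fact n)"

lemma op_exp_sums:
  fixes A :: "real ^ 'a \<Rightarrow> real ^ 'a::finite"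
  assumes "linear A"
  shows "(\<lambda>n. (A ^^ n) f /\<^sub>R fact n) sums op_exp A f"
  unfolding op_exp_def
proof (rule summable_sums)
  have "bounded_linear A" using assms by (simp add: linear_conv_bounded_linear)
  then obtain K where K: "K > 0" "\<And>g. norm (A g) \<le> norm g * K"
    using bounded_linear.pos_bounded by blast
  have bound: "norm ((A ^^ n) f) \<le> K ^ n * norm f" for n
  proof (induction n)
    case (Suc n)
    have "norm ((A ^^ Suc n) f) \<le> norm ((A ^^ n) f) * K" using K(2) by simp
    also have "\<dots> \<le> (K ^ n * norm f) * K" using Suc K(1) by (intro mult_right_mono) auto
    finally show ?case by (simp add: mult_ac)
  qed simp
  have "summable (\<lambda>n. (K ^ n /\<^sub>R fact n) * norm f)"
    by (intro summable_mult2 summable_exp_generic)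
  then show "summable (\<lambda>n. (A ^^ n) f /\<^sub>R fact n)"
  proof (rule summable_comparison_test'[where N = 0])
    fix n :: nat
    have "norm ((A ^^ n) f /\<^sub>R fact n) = norm ((A ^^ n) f) * inverse (fact n)" by simp
    also have "\<dots> \<le> (K ^ n * norm f) * inverse (fact n)"
      by (intro mult_right_mono bound) simp
    finally show "norm ((A ^^ n) f /\<^sub>R fact n) \<le> (K ^ n /\<^sub>R fact n) * norm f"
      by (simp add: mult_ac)
  qed
qed

definition lp_norm :: "('a::finite \<Rightarrow> real) \<Rightarrow> ennreal \<Rightarrow> real ^ 'a \<Rightarrow> real"
  where "lp_norm m p f =
    (if p = \<infinity> then Max (range (\<lambda>x. \<bar>f $ x\<bar>))
     else (\<Sum>x\<in>UNIV. m x * \<bar>f $ x\<bar> powr enn2real p) powr (1 / enn2real p))"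

end

theory Submission
  imports Defs
begin

text \<open>
  On \<open>k\<close>-cells the curvature bound says that for large \<open>c\<close> the absolute row sums of \<open>c - H\<close> are at
  most \<open>c - R\<close>. Expanding \<open>exp (- t H) = exp (- t c) exp (t (c - H))\<close> as a series gives the estimate
  for \<open>p = \<infinity>\<close>, that is, a bound on the absolute row sums of the matrix of \<open>exp (- t H)\<close>. This matrix
  is symmetric with respect to the weight, so the Schur test yields all \<open>p\<close> without interpolation.
  Conversely, the estimate for \<open>p = \<infinity>\<close>, applied to the sign pattern of a row of \<open>H\<close> and
  differentiated at \<open>t = 0\<close>, gives back the curvature bound.
\<close>

section \<open>Exponentials of linear operators\<close>

lemma linear_nth_expansion:
  fixes A :: "real ^ 'a::finite \<Rightarrow> real ^ 'a"
  assumes "linear A"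
  shows "A f $ x = (\<Sum>y\<in>UNIV. f $ y * A (cell_fun y) $ x)"
proof -
  have "f = (\<Sum>y\<in>UNIV. f $ y *\<^sub>R cell_fun y)"
    using basis_expansion[of f] by (simp add: scalar_mult_eq_scaleR)
  then have "A f = A (\<Sum>y\<in>UNIV. f $ y *\<^sub>R cell_fun y)" by simp
  also have "\<dots> = (\<Sum>y\<in>UNIV. f $ y *\<^sub>R A (cell_fun y))"
    by (simp add: linear_sum[OF assms] linear_scale[OF assms])
  finally show ?thesis by simp
qed

lemma linear_funpow:
  fixes A :: "'v::real_vector \<Rightarrow> 'v"
  assumes "linear A"
  shows "linear (A ^^ n)"
proof (induction n)
  case 0
  show ?case by (simp add: linear_id[unfolded id_def] id_def)
next
  case (Suc n)
  then show ?case using linear_compose[of "A ^^ n" A] assms by (simp add: o_def)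
qed

lemma funpow_scaleR:
  fixes A :: "'v::real_vector \<Rightarrow> 'v"
  assumes "linear A"
  shows "((\<lambda>g. c *\<^sub>R A g) ^^ n) f = c ^ n *\<^sub>R (A ^^ n) f"
  by (induction n) (simp_all add: linear_scale[OF assms])

lemma op_exp_nth_sums:
  assumes "linear A"
  shows "(\<lambda>n. (A ^^ n) f $ x / fact n) sums (op_exp A f $ x)"
proof -
  have "(\<lambda>n. ((A ^^ n) f /\<^sub>R fact n) $ x) sums (op_exp A f $ x)"
    by (intro bounded_linear.sums[OF bounded_linear_vec_nth] op_exp_sums assms)
  then show ?thesis by (simp add: divide_inverse mult.commute)
qed

text \<open>Pulling the scalar out of the iterates makes each entry a power series in
  \<open>c\<close>, so that absolute convergence and termwise differentiation become
  available.\<close>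

lemma op_exp_scaleR_nth_sums:
  assumes "linear A"
  shows "(\<lambda>n. (A ^^ n) f $ x / fact n * c ^ n) sums (op_exp (\<lambda>g. c *\<^sub>R A g) f $ x)"
proof -
  have "linear (\<lambda>g. c *\<^sub>R A g)" using assms by (rule linear_compose_scale_right)
  from op_exp_nth_sums[OF this, of f x] show ?thesis
    by (simp add: funpow_scaleR[OF assms] mult.commute)
qed

text \<open>The power series in the scalar converges at 2, hence absolutely at the smaller argument
  1.\<close>

lemma op_exp_nth_abs_summable:
  fixes A :: "real ^ 'a::finite \<Rightarrow> real ^ 'a"
  assumes "linear A"
  shows "summable (\<lambda>n. norm ((A ^^ n) f $ x / fact n))"
  using powser_insidea[where x = 2 and z = 1, OF sums_summable[OF op_exp_scaleR_nth_sums[OF assms]]]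
  by simp

lemma linear_op_exp:
  assumes "linear A"
  shows "linear (op_exp A)"
proof (rule linearI)
  note lin = linear_funpow[OF assms]
  fix f g
  have "(\<lambda>n. (A ^^ n) f /\<^sub>R fact n + (A ^^ n) g /\<^sub>R fact n) sums (op_exp A f + op_exp A g)"
    by (intro sums_add op_exp_sums assms)
  then have "(\<lambda>n. (A ^^ n) (f + g) /\<^sub>R fact n) sums (op_exp A f + op_exp A g)"
    by (simp add: linear_add[OF lin] scaleR_add_right)
  then show "op_exp A (f + g) = op_exp A f + op_exp A g"
    using op_exp_sums[OF assms] sums_unique2 by blast
next
  note lin = linear_funpow[OF assms]
  fix r f
  have "(\<lambda>n. r *\<^sub>R ((A ^^ n) f /\<^sub>R fact n)) sums (r *\<^sub>R op_exp A f)"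
    by (intro sums_scaleR_right op_exp_sums assms)
  then have "(\<lambda>n. (A ^^ n) (r *\<^sub>R f) /\<^sub>R fact n) sums (r *\<^sub>R op_exp A f)"
    by (simp add: linear_scale[OF lin] mult.commute)
  then show "op_exp A (r *\<^sub>R f) = r *\<^sub>R op_exp A f"
    using op_exp_sums[OF assms] sums_unique2 by blast
qed

text \<open>This is the binomial theorem for \<open>A\<close> and a multiple of the identity, which
  commute. Division by the factorial turns it into the general term of a Cauchy product.\<close>

lemma op_exp_series_shift:
  fixes A :: "'v::real_vector \<Rightarrow> 'v"
  assumes lin: "linear A"
  shows "((\<lambda>g. A g + a *\<^sub>R g) ^^ n) f /\<^sub>R fact n
    = (\<Sum>i\<le>n. (a ^ i / fact i) *\<^sub>R ((A ^^ (n - i)) f /\<^sub>R fact (n - i)))"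
proof (induction n)
  case 0
  show ?case by simp
next
  case (Suc n)
  define L where "L = (\<lambda>g. A g + a *\<^sub>R g)"
  define S where "S n = (A ^^ n) f /\<^sub>R fact n" for n
  define e where "e n = a ^ n / fact n" for n
  have IH: "(L ^^ n) f /\<^sub>R fact n = (\<Sum>i\<le>n. e i *\<^sub>R S (n - i))"
    using Suc unfolding L_def S_def e_def .
  have linL: "linear L"
    unfolding L_def by (intro linear_compose_add lin linear_compose_scale_right linear_ident)
  have AS: "A (S n) = real (Suc n) *\<^sub>R S (Suc n)" for n
    by (simp add: S_def linear_scale[OF lin] field_simps del: of_nat_Suc)
  have ae: "a * e n = real (Suc n) * e (Suc n)" for n
    by (simp add: e_def field_simps del: of_nat_Suc)
  \<comment> \<open>Applying \<open>L\<close> raises one of the two indices in each product: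
    \<open>A\<close> contributes the factor \<open>Suc n - i\<close>, multiplication by
    \<open>a\<close> the factor \<open>i\<close>, and these add up to \<open>Suc n\<close>.\<close>
  have "real (Suc n) *\<^sub>R ((L ^^ Suc n) f /\<^sub>R fact (Suc n)) = L ((L ^^ n) f /\<^sub>R fact n)"
    by (simp add: linear_scale[OF linL] field_simps del: of_nat_Suc)
  also have "\<dots> = A (\<Sum>i\<le>n. e i *\<^sub>R S (n - i)) + a *\<^sub>R (\<Sum>i\<le>n. e i *\<^sub>R S (n - i))"
    unfolding IH by (simp only: L_def)
  also have "A (\<Sum>i\<le>n. e i *\<^sub>R S (n - i)) = (\<Sum>i\<le>n. real (Suc n - i) *\<^sub>R (e i *\<^sub>R S (Suc n - i)))"
    unfolding linear_sum[OF lin]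
    by (intro sum.cong refl) (simp add: linear_scale[OF lin] AS Suc_diff_le)
  \<comment> \<open>The added summand \<open>i = Suc n\<close> has factor 0.\<close>
  also have "\<dots> = (\<Sum>i\<le>Suc n. real (Suc n - i) *\<^sub>R (e i *\<^sub>R S (Suc n - i)))"
    by simp
  also have "a *\<^sub>R (\<Sum>i\<le>n. e i *\<^sub>R S (n - i)) = (\<Sum>i\<le>n. real (Suc i) *\<^sub>R (e (Suc i) *\<^sub>R S (n - i)))"
    unfolding scaleR_sum_right scaleR_scaleR ae ..
  \<comment> \<open>After the index shift, the added summand \<open>i = 0\<close> has factor 0 as
    well.\<close>
  also have "\<dots> = (\<Sum>i\<le>Suc n. real i *\<^sub>R (e i *\<^sub>R S (Suc n - i)))"
    by (subst sum.atMost_Suc_shift) simp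
  also have "(\<Sum>i\<le>Suc n. real (Suc n - i) *\<^sub>R (e i *\<^sub>R S (Suc n - i))) + \<dots>
      = (\<Sum>i\<le>Suc n. real (Suc n) *\<^sub>R (e i *\<^sub>R S (Suc n - i)))"
    unfolding sum.distrib[symmetric] scaleR_add_left[symmetric]
    by (intro sum.cong refl) (simp add: of_nat_diff)
  also have "\<dots> = real (Suc n) *\<^sub>R (\<Sum>i\<le>Suc n. e i *\<^sub>R S (Suc n - i))"
    by (simp only: scaleR_sum_right)
  finally have "(L ^^ Suc n) f /\<^sub>R fact (Suc n) = (\<Sum>i\<le>Suc n. e i *\<^sub>R S (Suc n - i))"
    by (metis (no_types, lifting) of_nat_0_eq_iff old.nat.distinct(2) scaleR_cancel_left)
  then show ?case unfolding L_def S_def e_def .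
qed

text \<open>One of the two commuting summands is scalar, so the exponential law reduces in each
  entry to the Cauchy product of two absolutely convergent real series.\<close>

lemma op_exp_shift:
  assumes lin: "linear A"
  shows "op_exp (\<lambda>g. A g + a *\<^sub>R g) f = exp a *\<^sub>R op_exp A f"
proof -
  have linL: "linear (\<lambda>g. A g + a *\<^sub>R g)"
    by (intro linear_compose_add lin linear_compose_scale_right linear_ident)
  have e: "(\<lambda>n. a ^ n / fact n) sums exp a"
    using exp_converges[of a] by (simp add: divide_inverse mult.commute)
  have "op_exp (\<lambda>g. A g + a *\<^sub>R g) f $ x = exp a * op_exp A f $ x" for x
  proof -
    have "(\<lambda>n. \<Sum>i\<le>n. a ^ i / fact i * ((A ^^ (n - i)) f $ x / fact (n - i))) sums
      ((\<Sum>n. a ^ n / fact n) * (\<Sum>n. (A ^^ n) f $ x / fact n))"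
      using summable_norm_exp[of a]
      by (intro Cauchy_product_sums op_exp_nth_abs_summable lin)
        (simp add: divide_inverse mult.commute)
    also have "(\<Sum>n. a ^ n / fact n) = exp a" by (rule sums_unique[OF e, symmetric])
    also have "(\<Sum>n. (A ^^ n) f $ x / fact n) = op_exp A f $ x"
      by (rule sums_unique[OF op_exp_nth_sums[OF lin], symmetric])
    also have "(\<lambda>n. \<Sum>i\<le>n. a ^ i / fact i * ((A ^^ (n - i)) f $ x / fact (n - i)))
      = (\<lambda>n. ((\<lambda>g. A g + a *\<^sub>R g) ^^ n) f $ x / fact n)"
    proof
      fix n
      show "(\<Sum>i\<le>n. a ^ i / fact i * ((A ^^ (n - i)) f $ x / fact (n - i)))
        = ((\<lambda>g. A g + a *\<^sub>R g) ^^ n) f $ x / fact n"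
        using arg_cong[OF op_exp_series_shift[OF lin, where a = a and n = n and f = f], of "\<lambda>v. v $ x"]
        by (simp add: divide_inverse mult_ac)
    qed
    finally show ?thesis using op_exp_nth_sums[OF linL] sums_unique2 by blast
  qed
  then show ?thesis by (simp add: vec_eq_iff)
qed

text \<open>Each entry is an everywhere convergent power series in \<open>t\<close>; its derivative
  at 0 is the coefficient of the first power.\<close>

lemma op_exp_has_derivative_0:
  assumes lin: "linear A"
  shows "((\<lambda>t. op_exp (\<lambda>g. t *\<^sub>R A g) f $ x) has_real_derivative A f $ x) (at 0)"
proof -
  define c where "c n = (A ^^ n) f $ x / fact n" for n
  have s: "(\<lambda>n. c n * t ^ n) sums (op_exp (\<lambda>g. t *\<^sub>R A g) f $ x)" for t
    unfolding c_def by (rule op_exp_scaleR_nth_sums[OF lin])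
  then have "((\<lambda>t. \<Sum>n. c n * t ^ n) has_real_derivative (\<Sum>n. diffs c n * 0 ^ n)) (at 0)"
    by (intro termdiffs_strong_converges_everywhere) (auto simp: sums_iff)
  moreover have "(\<lambda>t. \<Sum>n. c n * t ^ n) = (\<lambda>t. op_exp (\<lambda>g. t *\<^sub>R A g) f $ x)"
    using s by (auto simp: sums_iff)
  moreover have "(\<Sum>n. diffs c n * 0 ^ n) = A f $ x"
    unfolding powser_zero by (simp add: diffs_def c_def)
  ultimately show ?thesis by simp
qed

section \<open>Self-adjoint operators\<close>

lemma winner_cell_fun: "winner m (cell_fun x) h = h $ x * m x"
proof -
  have "winner m (cell_fun x) h = (\<Sum>y\<in>UNIV. if y = x then h $ y * m y else 0)"
    unfolding winner_def by (rule sum.cong) (auto simp: axis_def)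
  then show ?thesis by simp
qed

lemma winner_commute: "winner m f g = winner m g f"
  unfolding winner_def by (simp add: mult_ac)

lemma bounded_linear_winner_right: "bounded_linear (winner m f)"
proof -
  have "linear (winner m f)"
    by (rule linearI) (simp_all add: winner_def algebra_simps sum.distrib sum_distrib_left)
  then show ?thesis by (simp add: linear_conv_bounded_linear)
qed

text \<open>Pairing with \<open>cell_fun x\<close> isolates the entry at \<open>x\<close> up to the
  factor \<open>m x\<close>. The formula reduces linearity and support of the adjoint to properties
  of \<open>winner\<close> and \<open>A\<close>.\<close>

lemma wadjoint_nth:
  assumes "\<And>x. m x > 0" "linear A"
  shows "wadjoint m A g $ x = winner m (A (cell_fun x)) g / m x"
  using winner_wadjoint[OF assms, where f = "cell_fun x" and g = g] assms(1)[of x]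
  by (simp add: winner_cell_fun)

lemma linear_wadjoint:
  assumes "\<And>x. m x > 0" "linear A"
  shows "linear (wadjoint m A)"
proof -
  note l = bounded_linear.linear[OF bounded_linear_winner_right]
  show ?thesis
    by (rule linearI)
      (simp_all add: vec_eq_iff wadjoint_nth[OF assms] linear_add[OF l] linear_scale[OF l]
        add_divide_distrib)
qed

text \<open>Self-adjointness passes to all iterates, and then to the sum of the series because
  \<open>winner\<close> is continuous in its second argument.\<close>

lemma op_exp_self_adjoint:
  assumes lin: "linear A" and sa: "\<And>f g. winner m (A f) g = winner m f (A g)"
  shows "winner m (op_exp A f) g = winner m f (op_exp A g)"
proof -
  have sa_n: "winner m ((A ^^ n) f) g = winner m f ((A ^^ n) g)" for n
    by (induction n arbitrary: f g) (simp_all add: sa funpow_swap1)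
  have "(\<lambda>n. winner m u ((A ^^ n) v /\<^sub>R fact n)) sums winner m u (op_exp A v)" for u v
    by (intro bounded_linear.sums[OF bounded_linear_winner_right] op_exp_sums lin)
  then have s: "(\<lambda>n. winner m u ((A ^^ n) v) / fact n) sums winner m u (op_exp A v)" for u v
    by (simp add: linear_scale[OF bounded_linear.linear[OF bounded_linear_winner_right]]
        divide_inverse mult.commute)
  show ?thesis
    using s[of f g] s[of g f] sums_unique2 by (auto simp: sa_n winner_commute[of m g])
qed

section \<open>The Schur test\<close>

text \<open>The tangent to the convex function \<open>u powr p\<close> at 1 lies below its graph.
  The proof uses the weighted mean inequality for \<open>u powr p\<close> and 1, with weights
  \<open>1 / p\<close> and \<open>1 - 1 / p\<close>.\<close>

lemma powr_Bernoulli: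
  fixes u p :: real
  assumes "u \<ge> 0" "p \<ge> 1"
  shows "p * u \<le> u powr p + (p - 1)"
proof (cases "u = 0")
  case False
  then have "(u powr p) powr (1 / p) * 1 powr (1 - 1 / p) \<le> 1 / p * u powr p + (1 - 1 / p) * 1"
    using assms by (intro Youngs_inequality_0) auto
  then have "u \<le> 1 / p * u powr p + (1 - 1 / p)"
    using assms False by (simp add: powr_powr)
  then have "p * u \<le> p * (1 / p * u powr p + (1 - 1 / p))"
    using assms by (intro mult_left_mono) auto
  also have "\<dots> = u powr p + (p - 1)"
    using assms by (simp add: field_simps)
  finally show ?thesis .
qed (use assms in auto)

text \<open>Jensen's inequality for the power function, with total weight at most \<open>M\<close>
  rather than equal to it: the missing mass may be thought of as sitting at the value 0.\<close>

lemma powr_weighted_mean: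
  fixes w a :: "'i \<Rightarrow> real"
  assumes M: "M > 0" and p: "p \<ge> 1"
    and w: "\<And>i. i \<in> S \<Longrightarrow> w i \<ge> 0" and a: "\<And>i. i \<in> S \<Longrightarrow> a i \<ge> 0" and sum: "sum w S \<le> M"
  shows "M * ((\<Sum>i\<in>S. w i * a i) / M) powr p \<le> (\<Sum>i\<in>S. w i * a i powr p)"
proof (cases "(\<Sum>i\<in>S. w i * a i) = 0")
  case True
  then show ?thesis using w by (simp add: sum_nonneg)
next
  case False
  \<comment> \<open>Dividing all values by the mean \<open>s\<close> moves the point of tangency to
    1, where \<open>powr_Bernoulli\<close> applies.\<close>
  define s where "s = (\<Sum>i\<in>S. w i * a i) / M"
  have s: "s > 0"
    unfolding s_def using False M w a by (intro divide_pos_pos) (auto simp: order_less_le sum_nonneg)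
  have "(\<Sum>i\<in>S. w i * a i) = M * s" using M by (simp add: s_def)
  then have "p * M = p * (\<Sum>i\<in>S. w i * a i) / s" using s by simp
  also have "\<dots> = (\<Sum>i\<in>S. w i * (p * (a i / s)))"
    by (simp add: sum_distrib_left sum_divide_distrib mult_ac)
  also have "\<dots> \<le> (\<Sum>i\<in>S. w i * ((a i / s) powr p + (p - 1)))"
    using w a s p by (intro sum_mono mult_left_mono powr_Bernoulli) auto
  also have "\<dots> = (\<Sum>i\<in>S. w i * a i powr p) / s powr p + (p - 1) * sum w S"
    using a s by (simp add: powr_divide algebra_simps sum.distrib sum_subtractf
        sum_divide_distrib sum_distrib_left)
  \<comment> \<open>The deficit in total weight goes in the right direction since
    \<open>p - 1\<close> is nonnegative.\<close>
  also have "\<dots> \<le> (\<Sum>i\<in>S. w i * a i powr p) / s powr p + (p - 1) * M"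
    using sum p by (intro add_left_mono mult_left_mono) auto
  finally have "M \<le> (\<Sum>i\<in>S. w i * a i powr p) / s powr p" by (simp add: algebra_simps)
  then show ?thesis using s by (simp add: pos_le_divide_eq flip: s_def)
qed

text \<open>Jensen is applied in each row with weights \<open>\<bar>q x y\<bar>\<close>. Symmetry
  with respect to \<open>m\<close> then turns the weighted column sums into row sums, so one bound
  \<open>M\<close> serves twice.\<close>

lemma Schur_test_symmetric:
  fixes q :: "'i \<Rightarrow> 'i \<Rightarrow> real"
  assumes M: "M > 0" and p: "p \<ge> 1" and m: "\<And>x. x \<in> S \<Longrightarrow> m x > 0"
    and row: "\<And>x. x \<in> S \<Longrightarrow> (\<Sum>y\<in>S. \<bar>q x y\<bar>) \<le> M"
    and sym: "\<And>x y. x \<in> S \<Longrightarrow> y \<in> S \<Longrightarrow> m x * q x y = m y * q y x"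
  shows "(\<Sum>x\<in>S. m x * \<bar>\<Sum>y\<in>S. f y * q x y\<bar> powr p) \<le> M powr p * (\<Sum>x\<in>S. m x * \<bar>f x\<bar> powr p)"
proof -
  have abs_sym: "m x * \<bar>q x y\<bar> = m y * \<bar>q y x\<bar>" if "x \<in> S" "y \<in> S" for x y
    using arg_cong[OF sym[OF that], of abs] m[of x] m[of y] that by (simp add: abs_mult)
  \<comment> \<open>The factor \<open>M powr p / M\<close> is the power of \<open>M\<close> with
    exponent \<open>p - 1\<close>; the last power comes from the column sums.\<close>
  have row_p: "\<bar>\<Sum>y\<in>S. f y * q x y\<bar> powr p \<le> M powr p / M * (\<Sum>y\<in>S. \<bar>q x y\<bar> * \<bar>f y\<bar> powr p)"
    if x: "x \<in> S" for x
  proof -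
    have "\<bar>\<Sum>y\<in>S. f y * q x y\<bar> powr p \<le> (\<Sum>y\<in>S. \<bar>q x y\<bar> * \<bar>f y\<bar>) powr p"
      using p by (intro powr_mono2 order_trans[OF sum_abs]) (auto simp: abs_mult mult.commute)
    also have "\<dots> = M powr p / M * (M * ((\<Sum>y\<in>S. \<bar>q x y\<bar> * \<bar>f y\<bar>) / M) powr p)"
      using M by (simp add: powr_divide sum_nonneg)
    also have "\<dots> \<le> M powr p / M * (\<Sum>y\<in>S. \<bar>q x y\<bar> * \<bar>f y\<bar> powr p)"
      using M p row[OF x] by (intro mult_left_mono powr_weighted_mean) auto
    finally show ?thesis .
  qed
  have "(\<Sum>x\<in>S. m x * \<bar>\<Sum>y\<in>S. f y * q x y\<bar> powr p)
      \<le> (\<Sum>x\<in>S. m x * (M powr p / M * (\<Sum>y\<in>S. \<bar>q x y\<bar> * \<bar>f y\<bar> powr p)))"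
    using m by (intro sum_mono mult_left_mono row_p) (auto intro: less_imp_le)
  also have "\<dots> = M powr p / M * (\<Sum>x\<in>S. \<Sum>y\<in>S. m x * \<bar>q x y\<bar> * \<bar>f y\<bar> powr p)"
    by (simp add: sum_distrib_left mult_ac)
  also have "(\<Sum>x\<in>S. \<Sum>y\<in>S. m x * \<bar>q x y\<bar> * \<bar>f y\<bar> powr p)
      = (\<Sum>y\<in>S. \<Sum>x\<in>S. m y * \<bar>q y x\<bar> * \<bar>f y\<bar> powr p)"
    by (subst sum.swap) (intro sum.cong refl, simp add: abs_sym)
  also have "\<dots> = (\<Sum>y\<in>S. m y * \<bar>f y\<bar> powr p * (\<Sum>x\<in>S. \<bar>q y x\<bar>))"
    by (simp add: sum_distrib_left mult_ac)
  also have "M powr p / M * \<dots> \<le> M powr p / M * (\<Sum>y\<in>S. m y * \<bar>f y\<bar> powr p * M)"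
    using M m row by (intro mult_left_mono sum_mono mult_nonneg_nonneg) (auto intro: less_imp_le)
  also have "\<dots> = M powr p * (\<Sum>x\<in>S. m x * \<bar>f x\<bar> powr p)"
    using M by (simp add: sum_distrib_right[symmetric])
  finally show ?thesis .
qed

section \<open>The Hodge Laplacian\<close>

lemma linear_hodge:
  assumes "\<And>x. m x > 0" "linear \<delta>"
  shows "linear (hodge \<delta> m)"
  using linear_compose_add[OF linear_compose[OF linear_wadjoint[OF assms] assms(2)]
      linear_compose[OF assms(2) linear_wadjoint[OF assms]]]
  by (simp add: hodge_def[abs_def] o_def)

lemma hodge_self_adjoint:
  assumes "\<And>x. m x > 0" "linear \<delta>"
  shows "winner m (hodge \<delta> m f) g = winner m f (hodge \<delta> m g)"
proof -
  note l = linear_add[OF bounded_linear.linear[OF bounded_linear_winner_right]]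
  note w = winner_wadjoint[OF assms]
  have w': "winner m (wadjoint m \<delta> u) v = winner m u (\<delta> v)" for u v
    using w[where f = v and g = u] by (simp add: winner_commute)
  have "winner m (hodge \<delta> m f) g = winner m (\<delta> (wadjoint m \<delta> f)) g + winner m (wadjoint m \<delta> (\<delta> f)) g"
    by (simp add: hodge_def l winner_commute[of m _ g])
  also have "\<dots> = winner m f (\<delta> (wadjoint m \<delta> g)) + winner m f (wadjoint m \<delta> (\<delta> g))"
    by (simp only: w w')
  finally show ?thesis by (simp add: hodge_def l)
qed

lemma (in cell_complex) coboundary_nonzero:
  assumes "\<delta> f $ z \<noteq> 0"
  obtains x where "f $ x \<noteq> 0" "cdim z = cdim x + 1"
proof -
  obtain x where "f $ x * \<delta> (cell_fun x) $ z \<noteq> 0"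
    using assms unfolding linear_nth_expansion[OF linear_coboundary, of f]
    by (meson sum.not_neutral_contains_not_neutral)
  then show thesis using that[of x] incidence_dim[of z x] by auto
qed

text \<open>Up to weights the adjoint has the transposed matrix, so the same incidences are
  traversed downwards in dimension.\<close>

lemma (in cell_complex) wadjoint_coboundary_nonzero:
  assumes "wadjoint m \<delta> f $ x \<noteq> 0"
  obtains z where "f $ z \<noteq> 0" "cdim z = cdim x + 1"
proof -
  have "(\<Sum>z\<in>UNIV. \<delta> (cell_fun x) $ z * f $ z * m z) \<noteq> 0"
    using assms by (auto simp: wadjoint_nth[OF weight_pos linear_coboundary] winner_def)
  then obtain z where "\<delta> (cell_fun x) $ z * f $ z * m z \<noteq> 0"
    by (meson sum.not_neutral_contains_not_neutral)
  then show thesis using that[of z] incidence_dim[of z x] by auto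
qed

text \<open>Both summands go one dimension up and one down, in either order, so a nonzero value can
  be traced back to a cell of the same dimension.\<close>

lemma (in cell_complex) hodge_cochains:
  assumes "f \<in> cochains cdim k"
  shows "hodge \<delta> m f \<in> cochains cdim k"
proof -
  have "cdim x = k" if "hodge \<delta> m f $ x \<noteq> 0" for x
  proof -
    have f: "cdim y = k" if "f $ y \<noteq> 0" for y
      using assms that by (auto simp: cochains_def cells_def)
    have "\<delta> (wadjoint m \<delta> f) $ x \<noteq> 0 \<or> wadjoint m \<delta> (\<delta> f) $ x \<noteq> 0"
      using that by (auto simp: hodge_def)
    then show ?thesis
    proof
      assume "\<delta> (wadjoint m \<delta> f) $ x \<noteq> 0"
      then show ?thesis
        by (elim coboundary_nonzero wadjoint_coboundary_nonzero) (use f in fastforce)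
    next
      assume "wadjoint m \<delta> (\<delta> f) $ x \<noteq> 0"
      then show ?thesis
        by (elim coboundary_nonzero wadjoint_coboundary_nonzero) (use f in fastforce)
    qed
  qed
  then show ?thesis by (auto simp: cochains_def cells_def)
qed

section \<open>Semigroup bounds on an invariant block\<close>

text \<open>Only the block of the matrix indexed by \<open>S\<close> matters; in the application \<open>S\<close> is the set of
  \<open>k\<close>-cells.\<close>

locale symmetric_block =
  fixes m :: "'a::finite \<Rightarrow> real" and H :: "real ^ 'a \<Rightarrow> real ^ 'a" and S :: "'a set"
  assumes weight_pos: "m x > 0"
    and lin: "linear H"
    and self_adjoint: "winner m (H f) g = winner m f (H g)"
    and invariant: "\<lbrakk>\<And>x. x \<notin> S \<Longrightarrow> f $ x = 0; x \<notin> S\<rbrakk> \<Longrightarrow> H f $ x = 0"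
begin

definition semigroup :: "real \<Rightarrow> real ^ 'a \<Rightarrow> real ^ 'a"
  where "semigroup t = op_exp (\<lambda>g. (- t) *\<^sub>R H g)"

text \<open>The sum runs over all cells, matching \<open>forman_curvature\<close>; for
  \<open>x\<close> in \<open>S\<close> the cells outside \<open>S\<close> contribute 0 by
  \<open>offdiagonal_zero\<close>.\<close>

definition curvature :: "'a \<Rightarrow> real"
  where "curvature x = H (cell_fun x) $ x - (\<Sum>y\<in>UNIV - {x}. \<bar>H (cell_fun y) $ x\<bar>)"

lemma lin_scaled: "linear (\<lambda>g. c *\<^sub>R H g)"
  using lin by (rule linear_compose_scale_right)

lemma linear_semigroup: "linear (semigroup t)"
  unfolding semigroup_def by (rule linear_op_exp[OF lin_scaled])

lemma semigroup_invariant: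
  assumes f: "\<And>x. x \<notin> S \<Longrightarrow> f $ x = 0" and x: "x \<notin> S"
  shows "semigroup t f $ x = 0"
proof -
  have "(H ^^ n) f $ x = 0" if "x \<notin> S" for n x
    using that by (induction n arbitrary: x) (simp_all add: f invariant)
  then have "(\<lambda>n. 0) sums (semigroup t f $ x)"
    using op_exp_scaleR_nth_sums[OF lin, of f x "- t"] x by (simp add: semigroup_def)
  then show ?thesis using sums_unique2 sums_zero by blast
qed

text \<open>Self-adjointness tested on two indicator functions; this is the symmetry that the Schur
  test requires.\<close>

lemma semigroup_symmetric:
  "m x * semigroup t (cell_fun y) $ x = m y * semigroup t (cell_fun x) $ y"
proof -
  have "winner m (c *\<^sub>R H f) g = winner m f (c *\<^sub>R H g)" for c f g
  proof -
    note l = linear_scale[OF bounded_linear.linear[OF bounded_linear_winner_right]]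
    show ?thesis by (metis l self_adjoint winner_commute)
  qed
  from op_exp_self_adjoint[OF lin_scaled this, of "- t" "cell_fun x" "cell_fun y"]
  show ?thesis
    by (simp add: semigroup_def winner_cell_fun winner_commute[of m _ "cell_fun y"] mult.commute)
qed

text \<open>Invariance kills the transposed entry, and self-adjointness carries this over because
  the weights are positive.\<close>

lemma offdiagonal_zero:
  assumes "x \<in> S" "y \<notin> S"
  shows "H (cell_fun y) $ x = 0"
proof -
  have "H (cell_fun x) $ y = 0"
    by (rule invariant) (use assms in \<open>auto simp: axis_def\<close>)
  then show ?thesis
    using self_adjoint[of "cell_fun y" "cell_fun x"] weight_pos[of x]
    by (simp add: winner_cell_fun winner_commute[of m _ "cell_fun x"])
qed

text \<open>Once \<open>c\<close> dominates the diagonal entry, row \<open>x\<close> of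
  \<open>c - H\<close> has absolute sum exactly \<open>c - curvature x\<close>.\<close>

lemma shifted_bound:
  assumes x: "x \<in> S" and curv: "curvature x \<ge> R" and c: "H (cell_fun x) $ x \<le> c"
    and B: "\<And>y. \<bar>f $ y\<bar> \<le> B"
  shows "\<bar>(c *\<^sub>R f - H f) $ x\<bar> \<le> (c - R) * B"
proof -
  have B0: "B \<ge> 0" using B[of x] by linarith
  have "H f $ x = f $ x * H (cell_fun x) $ x + (\<Sum>y\<in>UNIV - {x}. f $ y * H (cell_fun y) $ x)"
    by (simp add: linear_nth_expansion[OF lin, of f] sum.remove[of UNIV x])
  then have "(c *\<^sub>R f - H f) $ x
      = f $ x * (c - H (cell_fun x) $ x) - (\<Sum>y\<in>UNIV - {x}. f $ y * H (cell_fun y) $ x)"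
    by (simp add: algebra_simps)
  also have "\<bar>\<dots>\<bar> \<le> \<bar>f $ x\<bar> * (c - H (cell_fun x) $ x) + \<bar>\<Sum>y\<in>UNIV - {x}. f $ y * H (cell_fun y) $ x\<bar>"
    using c by (intro order_trans[OF abs_triangle_ineq4]) (simp add: abs_mult)
  also have "\<dots> \<le> B * (c - H (cell_fun x) $ x) + (\<Sum>y\<in>UNIV - {x}. B * \<bar>H (cell_fun y) $ x\<bar>)"
    using c B B0 by (intro add_mono mult_right_mono order_trans[OF sum_abs] sum_mono)
      (auto simp: abs_mult mult_right_mono)
  also have "\<dots> = (c - curvature x) * B"
    by (simp add: curvature_def sum_distrib_left[symmetric] algebra_simps)
  also have "\<dots> \<le> (c - R) * B" using curv B0 by (intro mult_right_mono) auto
  finally show ?thesis .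
qed

lemma semigroup_sup_bound:
  assumes curv: "\<And>x. x \<in> S \<Longrightarrow> curvature x \<ge> R" and t: "t \<ge> 0"
    and f: "\<And>x. x \<notin> S \<Longrightarrow> f $ x = 0" and B: "\<And>x. \<bar>f $ x\<bar> \<le> B"
  shows "\<bar>semigroup t f $ x\<bar> \<le> exp (- R * t) * B"
proof (cases "x \<in> S")
  case False
  have "B \<ge> 0" using B[of x] by linarith
  then show ?thesis using semigroup_invariant[OF f False, of t] by simp
next
  case x: True
  \<comment> \<open>The largest diagonal entry is a shift that works for all rows
    simultaneously.\<close>
  define c where "c = Max (range (\<lambda>x. H (cell_fun x) $ x))"
  have c: "H (cell_fun x) $ x \<le> c" for x unfolding c_def by (intro Max_ge) auto
  define G where "G = (\<lambda>g. c *\<^sub>R g - H g)"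
  have linG: "linear G"
    unfolding G_def by (intro linear_compose_sub linear_compose_scale_right linear_ident lin)
  \<comment> \<open>Nonnegativity of \<open>c - R\<close> makes the bound on the iterates of
    \<open>G\<close> valid also outside \<open>S\<close>, where they vanish.\<close>
  have "curvature x \<le> H (cell_fun x) $ x" by (simp add: curvature_def sum_nonneg)
  then have Rc: "R \<le> c" using curv[OF x] c[of x] by linarith
  have B0: "B \<ge> 0" using B[of x] by linarith
  have G0: "(G ^^ n) f $ y = 0" if "y \<notin> S" for n y
    using that by (induction n arbitrary: y) (simp_all add: f invariant G_def)
  have Gn: "\<bar>(G ^^ n) f $ y\<bar> \<le> (c - R) ^ n * B" for n y
  proof (induction n arbitrary: y)
    case 0
    show ?case using B by simp
  next
    case (Suc n)
    show ?case
    proof (cases "y \<in> S")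
      case True
      have "\<bar>(c *\<^sub>R ((G ^^ n) f) - H ((G ^^ n) f)) $ y\<bar> \<le> (c - R) * ((c - R) ^ n * B)"
        by (rule shifted_bound[OF True curv[OF True] c Suc])
      then show ?thesis by (simp add: G_def mult.assoc)
    next
      case False
      then show ?thesis using G0[of y "Suc n"] Rc B0 by simp
    qed
  qed
  have series: "(\<lambda>n. (G ^^ n) f $ x / fact n * t ^ n) sums (op_exp (\<lambda>g. t *\<^sub>R G g) f $ x)"
    by (rule op_exp_scaleR_nth_sums[OF linG])
  have "(\<lambda>n. (t * (c - R)) ^ n / fact n * B) sums (exp (t * (c - R)) * B)"
    using sums_mult2[OF exp_converges[of "t * (c - R)"], of B]
    by (simp add: divide_inverse mult.commute)
  note majorant = this
  have "norm ((G ^^ n) f $ x / fact n * t ^ n) \<le> (t * (c - R)) ^ n / fact n * B" for n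
    using mult_right_mono[OF Gn[of n x], of "t ^ n / fact n"] t
    by (simp add: abs_mult power_mult_distrib mult_ac)
  from norm_suminf_le[OF this sums_summable[OF majorant]]
  have exp_G: "\<bar>op_exp (\<lambda>g. t *\<^sub>R G g) f $ x\<bar> \<le> exp (t * (c - R)) * B"
    by (simp only: sums_unique[OF series, symmetric] sums_unique[OF majorant, symmetric] real_norm_def)
  \<comment> \<open>Here \<open>- t H\<close> is written as \<open>t G - t c\<close>, and the scalar
    part is split off.\<close>
  have "semigroup t f = op_exp (\<lambda>g. t *\<^sub>R G g + (- (t * c)) *\<^sub>R g) f"
    by (simp add: semigroup_def G_def algebra_simps)
  also have "\<dots> = exp (- (t * c)) *\<^sub>R op_exp (\<lambda>g. t *\<^sub>R G g) f"
    by (rule op_exp_shift[OF linear_compose_scale_right[OF linG]])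
  finally have "\<bar>semigroup t f $ x\<bar> \<le> exp (- (t * c)) * (exp (t * (c - R)) * B)"
    using exp_G by (simp add: abs_mult)
  also have "\<dots> = exp (- R * t) * B"
    by (simp add: mult.assoc[symmetric] exp_add[symmetric] algebra_simps)
  finally show ?thesis .
qed

text \<open>The sup bound is tested on the sign pattern of the row, cut off outside
  \<open>S\<close>; this function attains the absolute row sum.\<close>

lemma semigroup_row_sum:
  assumes curv: "\<And>x. x \<in> S \<Longrightarrow> curvature x \<ge> R" and t: "t \<ge> 0"
  shows "(\<Sum>y\<in>S. \<bar>semigroup t (cell_fun y) $ x\<bar>) \<le> exp (- R * t)"
proof -
  define f :: "real ^ 'a"
    where "f = (\<chi> y. if y \<in> S then sgn (semigroup t (cell_fun y) $ x) else 0)"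
  have "(\<Sum>y\<in>S. \<bar>semigroup t (cell_fun y) $ x\<bar>) = (\<Sum>y\<in>S. f $ y * semigroup t (cell_fun y) $ x)"
    by (intro sum.cong refl) (simp add: f_def abs_sgn mult.commute)
  also have "\<dots> = semigroup t f $ x"
    unfolding linear_nth_expansion[OF linear_semigroup, of t f]
    by (intro sum.mono_neutral_left) (auto simp: f_def)
  also have "\<dots> \<le> exp (- R * t) * 1"
    by (rule order_trans[OF abs_ge_self semigroup_sup_bound[OF curv t]])
      (auto simp: f_def abs_sgn_eq)
  finally show ?thesis by simp
qed

lemma semigroup_lp_bound:
  assumes curv: "\<And>x. x \<in> S \<Longrightarrow> curvature x \<ge> R" and t: "t \<ge> 0"
    and f: "\<And>x. x \<notin> S \<Longrightarrow> f $ x = 0" and p: "1 \<le> p"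
  shows "lp_norm m p (semigroup t f) \<le> exp (- R * t) * lp_norm m p f"
proof (cases "p = \<infinity>")
  case True
  have "\<bar>f $ x\<bar> \<le> Max (range (\<lambda>x. \<bar>f $ x\<bar>))" for x by (intro Max_ge) auto
  from semigroup_sup_bound[OF curv t f this] show ?thesis
    using True by (auto simp: lp_norm_def intro!: Max.boundedI)
next
  case False
  \<comment> \<open>The infinite exponent had to be split off first, since \<open>enn2real\<close>
    sends it to 0.\<close>
  define r where "r = enn2real p"
  have r: "r \<ge> 1"
    using p False enn2real_mono[of 1 p] by (simp add: r_def less_top)
  have sum_S: "(\<Sum>x\<in>UNIV. m x * \<bar>h $ x\<bar> powr r) = (\<Sum>x\<in>S. m x * \<bar>h $ x\<bar> powr r)"
    if "\<And>x. x \<notin> S \<Longrightarrow> h $ x = 0" for h :: "real ^ 'a"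
    using that by (intro sum.mono_neutral_right) auto
  have expand: "semigroup t f $ x = (\<Sum>y\<in>S. f $ y * semigroup t (cell_fun y) $ x)" for x
    unfolding linear_nth_expansion[OF linear_semigroup, of t f]
    using f by (intro sum.mono_neutral_right) auto
  have nonneg: "(\<Sum>x\<in>UNIV. m x * \<bar>h $ x\<bar> powr r) \<ge> 0" for h :: "real ^ 'a"
    by (intro sum_nonneg mult_nonneg_nonneg) (auto intro: less_imp_le weight_pos)
  have "(\<Sum>x\<in>UNIV. m x * \<bar>semigroup t f $ x\<bar> powr r)
      = (\<Sum>x\<in>S. m x * \<bar>semigroup t f $ x\<bar> powr r)"
    by (intro sum_S semigroup_invariant f)
  also have "\<dots> \<le> exp (- R * t) powr r * (\<Sum>x\<in>S. m x * \<bar>f $ x\<bar> powr r)"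
    unfolding expand
    by (intro Schur_test_symmetric r weight_pos semigroup_row_sum semigroup_symmetric curv t) auto
  also have "(\<Sum>x\<in>S. m x * \<bar>f $ x\<bar> powr r) = (\<Sum>x\<in>UNIV. m x * \<bar>f $ x\<bar> powr r)"
    by (intro sum_S[symmetric] f)
  finally have "(\<Sum>x\<in>UNIV. m x * \<bar>semigroup t f $ x\<bar> powr r) powr (1 / r)
      \<le> (exp (- R * t) powr r * (\<Sum>x\<in>UNIV. m x * \<bar>f $ x\<bar> powr r)) powr (1 / r)"
    using r nonneg by (intro powr_mono2) auto
  also have "\<dots> = exp (- R * t) * (\<Sum>x\<in>UNIV. m x * \<bar>f $ x\<bar> powr r) powr (1 / r)"
    using r by (simp add: powr_mult nonneg powr_powr)
  finally show ?thesis using False by (simp add: lp_norm_def r_def)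
qed

text \<open>The sign pattern of row \<open>x\<close> of \<open>H\<close> is a function \<open>f\<close> of sup norm 1 with
  \<open>f x = 1\<close> and \<open>H f x = curvature x\<close>; compare the derivatives of both sides at \<open>t = 0\<close>.\<close>

lemma curvature_ge_of_sup_bound:
  assumes x: "x \<in> S"
    and bound: "\<And>f t. \<lbrakk>\<And>y. y \<notin> S \<Longrightarrow> f $ y = 0; t \<ge> 0\<rbrakk>
      \<Longrightarrow> lp_norm m \<infinity> (semigroup t f) \<le> exp (- R * t) * lp_norm m \<infinity> f"
  shows "curvature x \<ge> R"
proof (rule ccontr)
  assume "\<not> curvature x \<ge> R"
  then have less: "curvature x < R" by simp
  define f :: "real ^ 'a"
    where "f = (\<chi> y. if y = x then 1 else - sgn (H (cell_fun y) $ x))"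
  \<comment> \<open>Outside \<open>S\<close> the row entry is 0, and so is its sign; hence the test
    function is admissible in \<open>bound\<close>.\<close>
  have f0: "f $ y = 0" if "y \<notin> S" for y
    using that x offdiagonal_zero[OF x that] by (auto simp: f_def)
  have "lp_norm m \<infinity> f \<le> 1"
    by (auto simp: lp_norm_def f_def abs_sgn_eq intro!: Max.boundedI)
  have le: "semigroup t f $ x \<le> exp (- R * t)" if "t \<ge> 0" for t
  proof -
    have "semigroup t f $ x \<le> lp_norm m \<infinity> (semigroup t f)"
      by (simp add: lp_norm_def) (rule order_trans[OF abs_ge_self Max_ge], auto)
    also have "\<dots> \<le> exp (- R * t) * lp_norm m \<infinity> f" using bound f0 that by blast
    also have "\<dots> \<le> exp (- R * t) * 1"
      using \<open>lp_norm m \<infinity> f \<le> 1\<close> by (intro mult_left_mono) auto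
    finally show ?thesis by simp
  qed
  have "(\<Sum>y\<in>UNIV - {x}. f $ y * H (cell_fun y) $ x) = (\<Sum>y\<in>UNIV - {x}. - \<bar>H (cell_fun y) $ x\<bar>)"
    by (intro sum.cong refl) (simp add: f_def abs_sgn mult.commute)
  then have "H f $ x = curvature x"
    unfolding linear_nth_expansion[OF lin, of f] curvature_def
    by (subst sum.remove[of UNIV x]) (simp_all add: f_def sum_negf)
  moreover have "((\<lambda>t. semigroup t f $ x) has_real_derivative - (H f $ x)) (at 0)"
    using op_exp_has_derivative_0[OF lin_scaled[of "- 1"], of f x] by (simp add: semigroup_def)
  ultimately have "((\<lambda>t. semigroup t f $ x - exp (- R * t)) has_real_derivative R - curvature x) (at 0)"
    by (auto intro!: derivative_eq_intros)
  \<comment> \<open>The difference starts at 0 with positive slope \<open>R - curvature x\<close>,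
    so it is positive for small positive times, against \<open>le\<close>.\<close>
  from DERIV_pos_inc_right[OF this] less obtain d where d: "d > 0"
    "\<And>h. 0 < h \<Longrightarrow> h < d \<Longrightarrow> semigroup 0 f $ x - exp (- R * 0)
      < semigroup h f $ x - exp (- R * h)"
    by auto
  \<comment> \<open>At time 0 only the constant term of the power series survives, which is
    \<open>f $ x\<close>.\<close>
  have "semigroup 0 f $ x = 1"
  proof -
    have "(\<lambda>n. (H ^^ n) f $ x / fact n * 0 ^ n) sums (semigroup 0 f $ x)"
      using op_exp_scaleR_nth_sums[OF lin, of f x 0] by (simp add: semigroup_def)
    from sums_unique2[OF this powser_sums_zero] show ?thesis by (simp add: f_def)
  qed
  then show False using d(2)[of "d / 2"] le[of "d / 2"] d(1) by simp
qed

end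

section \<open>Application of the block estimates to the \<open>k\<close>-cells\<close>

theorem theorem1p1:
  fixes cdim :: "'a::finite \<Rightarrow> nat"
    and \<delta> :: "real ^ 'a \<Rightarrow> real ^ 'a"
    and m :: "'a \<Rightarrow> real"
    and k :: nat
    and R :: real
  assumes "cell_complex cdim \<delta> m"
    and "k \<ge> 1"
  shows "(\<forall>x\<in>cells cdim k. forman_curvature \<delta> m x \<ge> R) \<longleftrightarrow>
    (\<forall>f\<in>cochains cdim k. \<forall>p::ennreal. \<forall>t::real. 1 \<le> p \<longrightarrow> 0 \<le> t \<longrightarrow>
      lp_norm m p (op_exp (\<lambda>g. (- t) *\<^sub>R hodge \<delta> m g) f) \<le> exp (- R * t) * lp_norm m p f)"
proof -
  interpret cell_complex cdim \<delta> m by fact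
  interpret block: symmetric_block m "hodge \<delta> m" "cells cdim k"
  proof (rule symmetric_block.intro)
    show "hodge \<delta> m f $ x = 0"
      if "\<And>x. x \<notin> cells cdim k \<Longrightarrow> f $ x = 0" "x \<notin> cells cdim k" for f x
      using hodge_cochains[of f k] that by (auto simp: cochains_def)
  qed (intro weight_pos linear_hodge hodge_self_adjoint linear_coboundary)+
  have curv: "block.curvature = forman_curvature \<delta> m"
    by (simp add: block.curvature_def forman_curvature_def fun_eq_iff)
  show ?thesis
    unfolding block.semigroup_def[symmetric]
  proof (intro iffI ballI allI impI)
    fix f and p :: ennreal and t :: real
    assume "\<forall>x\<in>cells cdim k. forman_curvature \<delta> m x \<ge> R" "f \<in> cochains cdim k" "1 \<le> p" "0 \<le> t"
    then show "lp_norm m p (block.semigroup t f) \<le> exp (- R * t) * lp_norm m p f"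
      by (intro block.semigroup_lp_bound) (auto simp: curv cochains_def)
  next
    fix x
    assume bound: "\<forall>f\<in>cochains cdim k. \<forall>p. \<forall>t. 1 \<le> p \<longrightarrow> 0 \<le> t \<longrightarrow>
        lp_norm m p (block.semigroup t f) \<le> exp (- R * t) * lp_norm m p f"
      and x: "x \<in> cells cdim k"
    \<comment> \<open>The estimate is specialised to the exponent
      \<open>\<infinity>\<close>.\<close>
    show "forman_curvature \<delta> m x \<ge> R"
      unfolding curv[symmetric]
      by (rule block.curvature_ge_of_sup_bound[OF x]) (use bound in \<open>auto simp: cochains_def\<close>)
  qed
qed

end
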